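(* Let $p$ be a prime and let $a,b\geq 1$ be integers. The $p$-adic valuation of the total number, over all sizes $n\ge 0$, of partitions having pairing index $a$ and pairing width $b$ equals the number of carries that occur when $a-1$ and $b-1$ are added in base $p$.
   Context: For an integer partition $\lambda$, pair equal parts of $\lambda$ as far as possible: for each part size occurring with odd multiplicity exactly one copy remains unpaired, and a part size of even multiplicity is completely paired. Let $r(\lambda)$ be the largest part size that participates in at least one pair (i.e. of multiplicity at least $2$), with $r(\lambda)=0$ if $\lambda$ has distinct parts. Write the unpaired parts (the part sizes of odd multiplicity, each once) in decreasing order $u_1>u_2>\cdots>u_j$ and let $s(\lambda)=u_1-u_2+u_3-u_4+\cdots$ (so $s(\lambda)=0$ if there are no unpaired parts). The pairing index of $\lambda$ is $T(\lambda)=r(\lambda)+s(\lambda)$. The pair span of $\lambda$ is the number of parts of $\lambda$ (counted with multiplicity) that belong to pairs. The residual span of $\lambda$ is $2\bigl(u_1-s(\lambda)\bigr)+1$ if there is at least one unpaired part, and $0$ if there are no unpaired parts. The pairing width $W(\lambda)$ is the larger of the pair span and the residual span. *)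

theory Defs
  imports Main "HOL-Library.Multiset" "HOL-Computational_Algebra.Primes"
begin

text \<open>An integer partition is a finite multiset of positive integers.\<close>

definition is_partition :: "nat multiset \<Rightarrow> bool" where
  "is_partition l \<longleftrightarrow> 0 \<notin># l"

definition unpaired_parts :: "nat multiset \<Rightarrow> nat list" where
  "unpaired_parts l = rev (sorted_list_of_set {k. odd (count l k)})"

definition largest_paired :: "nat multiset \<Rightarrow> nat" where
  "largest_paired l =
     (if \<exists>k. count l k \<ge> 2 then Max {k. count l k \<ge> 2} else 0)"

text \<open>Integer-valued, to avoid truncated subtraction.\<close>

fun alt_sum :: "nat list \<Rightarrow> int" where
  "alt_sum [] = 0"
| "alt_sum (x # xs) = int x - alt_sum xs"

definition residual_sum :: "nat multiset \<Rightarrow> int" where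
  "residual_sum l = alt_sum (unpaired_parts l)"

definition pairing_index :: "nat multiset \<Rightarrow> int" where
  "pairing_index l = int (largest_paired l) + residual_sum l"

definition pair_span :: "nat multiset \<Rightarrow> nat" where
  "pair_span l = (\<Sum>k\<in>set_mset l. 2 * (count l k div 2))"

definition residual_span :: "nat multiset \<Rightarrow> int" where
  "residual_span l =
     (case unpaired_parts l of
        [] \<Rightarrow> 0
      | u # _ \<Rightarrow> 2 * (int u - residual_sum l) + 1)"

definition pairing_width :: "nat multiset \<Rightarrow> int" where
  "pairing_width l = max (int (pair_span l)) (residual_span l)"

definition digit :: "nat \<Rightarrow> nat \<Rightarrow> nat \<Rightarrow> nat" where
  "digit p m i = (m div p ^ i) mod p"

text \<open>\<open>carry_in p m n i\<close> is the carry entering position \<open>i\<close> in the schoolbook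
  addition of \<open>m\<close> and \<open>n\<close> in base \<open>p\<close>; so the carry produced at position \<open>i\<close>
  is \<open>carry_in p m n (Suc i)\<close>.\<close>

fun carry_in :: "nat \<Rightarrow> nat \<Rightarrow> nat \<Rightarrow> nat \<Rightarrow> nat" where
  "carry_in p m n 0 = 0"
| "carry_in p m n (Suc i) = (digit p m i + digit p n i + carry_in p m n i) div p"

text \<open>For \<open>p \<ge> 2\<close> only finitely many positions produce a carry, so \<open>card\<close> is the
  actual count.\<close>

definition num_carries :: "nat \<Rightarrow> nat \<Rightarrow> nat \<Rightarrow> nat" where
  "num_carries p m n = card {i. carry_in p m n (Suc i) \<noteq> 0}"

definition index_width_partitions :: "nat \<Rightarrow> nat \<Rightarrow> nat multiset set" where
  "index_width_partitions a b =
     {l. is_partition l \<and> pairing_index l = int a \<and> pairing_width l = int b}"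

end

(* A partition splits uniquely as l = X + X + D, where X is the multiset of paired parts (one part
   per pair) and D the finite set of unpaired parts. Sets D inside {1..N} with alternating sum s are
   counted by N choose s: splitting off the element N turns s into N - s, and this is Pascal's rule.
   Multisets X with prescribed largest part and size are counted by stars and bars. A Vandermonde
   convolution over r + s = a then shows that exactly (a-1) + (b-1) choose (a-1) partitions have
   pairing index a and pairing width b, and Kummer's theorem gives the valuation. *)

theory Submission
  imports Defs "HOL-Computational_Algebra.Formal_Power_Series"
begin

section \<open>Valuations of factorials (Legendre), carries as quotients, and their
  comparison\<close>

section \<open>Kummer's theorem\<close>

text \<open>Powers with exponent beyond a bound exceed that bound, so all sums over exponents below
  can stop at a finite \<open>N\<close>.\<close>

lemma less_power_self:
  fixes p i :: nat
  assumes "p \<ge> 2"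
  shows "i < p ^ i"
proof -
  have "i < 2 ^ i" by simp
  also have "2 ^ i \<le> p ^ i" using assms by (simp add: power_mono)
  finally show ?thesis .
qed

lemma multiplicity_eq_card_powers:
  fixes p n N :: nat
  assumes "prime p" "0 < n" "n \<le> N"
  shows "multiplicity p n = card {i \<in> {1..N}. p ^ i dvd n}"
proof -
  have p: "p \<ge> 2" using assms(1) by (rule prime_ge_2_nat)
  have dvd: "p ^ i dvd n \<longleftrightarrow> i \<le> multiplicity p n" for i
    using assms p by (intro power_dvd_iff_le_multiplicity) auto
  have "i \<le> N" if "p ^ i dvd n" for i
  proof (rule ccontr)
    assume "\<not> i \<le> N"
    then have "n < p ^ i" using less_power_self[OF p, of i] assms by linarith
    with dvd_imp_le[OF that] assms show False by simp
  qed
  then have "{i \<in> {1..N}. p ^ i dvd n} = {1..multiplicity p n}"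
    using dvd by auto
  then show ?thesis by simp
qed

lemma Suc_div_eq:
  fixes n q :: nat
  shows "Suc n div q = n div q + of_bool (q dvd Suc n)"
  by (cases "q = 0") (auto simp: div_Suc dvd_eq_mod_eq_0)

text \<open>Passing from \<open>n\<close> to \<open>Suc n\<close> raises \<open>n div p ^ i\<close>
  by one exactly when \<open>p ^ i\<close> divides \<open>Suc n\<close>, and the number of such
  \<open>i\<close> is the multiplicity of \<open>p\<close> in \<open>Suc n\<close>. The free bound
  \<open>N\<close> lets factorials of different numbers share one range of summation.\<close>

lemma Legendre_formula:
  fixes p n N :: nat
  assumes "prime p" "n \<le> N"
  shows "multiplicity p (fact n :: nat) = (\<Sum>i\<in>{1..N}. n div p ^ i)"
  using assms(2)
proof (induction n)
  case 0
  then show ?case by simp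
next
  case (Suc n)
  have "multiplicity p (fact (Suc n) :: nat) = multiplicity p (Suc n * fact n)"
    by simp
  also have "\<dots> = multiplicity p (Suc n) + multiplicity p (fact n :: nat)"
    using assms(1) by (intro prime_elem_multiplicity_mult_distrib) auto
  also have "multiplicity p (Suc n) = (\<Sum>i\<in>{1..N}. of_bool (p ^ i dvd Suc n))"
    using multiplicity_eq_card_powers[OF assms(1) _ Suc.prems]
    by (simp add: Int_def)
  also have "multiplicity p (fact n :: nat) = (\<Sum>i\<in>{1..N}. n div p ^ i)"
    using Suc by simp
  finally show ?case
    by (simp only: Suc_div_eq sum.distrib add.commute)
qed

text \<open>The carry into position \<open>i\<close> is the overflow of adding the parts below that
  position. In the induction, division by \<open>p ^ Suc i\<close> is done first by
  \<open>p ^ i\<close>, which leaves the digits plus the old carry, and then by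
  \<open>p\<close>.\<close>

lemma carry_in_eq:
  assumes "p > 0"
  shows "carry_in p m n i = (m mod p ^ i + n mod p ^ i) div p ^ i"
proof (induction i)
  case 0
  then show ?case by simp
next
  case (Suc i)
  have mod: "k mod p ^ Suc i = p ^ i * digit p k i + k mod p ^ i" for k
    using mod_mult2_eq[of k "p ^ i" p] by (simp add: digit_def mult.commute)
  have "(m mod p ^ Suc i + n mod p ^ Suc i) div p ^ Suc i
      = (p ^ i * (digit p m i + digit p n i) + (m mod p ^ i + n mod p ^ i)) div p ^ i div p"
    unfolding mod by (simp add: div_mult2_eq[symmetric] algebra_simps)
  also have "\<dots> = (digit p m i + digit p n i + (m mod p ^ i + n mod p ^ i) div p ^ i) div p"
    using assms by simp
  finally show ?case by (simp add: Suc)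
qed

lemma carry_in_le_1:
  assumes "p > 0"
  shows "carry_in p m n i \<le> 1"
proof -
  have "k mod p ^ i < p ^ i" for k
    using assms by simp
  from this[of m] this[of n] have "m mod p ^ i + n mod p ^ i < 2 * p ^ i"
    by linarith
  then show ?thesis
    using assms unfolding carry_in_eq[OF assms] by (simp add: less_mult_imp_div_less less_Suc_eq_le[symmetric])
qed

text \<open>In Legendre's formula for \<open>(m + n)! = m! n! (m + n choose m)\<close>, the
  \<open>i\<close>-th quotient for \<open>m + n\<close> exceeds the sum of those for
  \<open>m\<close> and \<open>n\<close> by the carry into position \<open>i\<close>. Each carry is 0
  or 1, so their sum counts the nonzero ones.\<close>

theorem Kummer:
  assumes "prime p"
  shows "multiplicity p (m + n choose m) = num_carries p m n"
proof -
  have p: "p \<ge> 2" "p > 0" using assms prime_ge_2_nat[of p] by auto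
  let ?N = "m + n"
  have "(fact (m + n) :: nat) = fact m * fact n * (m + n choose m)"
    using binomial_fact_lemma[of m "m + n"] by simp
  then have "multiplicity p (fact (m + n) :: nat) =
      multiplicity p (fact m :: nat) + multiplicity p (fact n :: nat) + multiplicity p (m + n choose m)"
    using assms by (simp add: prime_elem_multiplicity_mult_distrib)
  moreover have "(m + n) div p ^ i = m div p ^ i + n div p ^ i + carry_in p m n i" for i
    unfolding carry_in_eq[OF p(2)] by (rule div_add1_eq)
  ultimately have "multiplicity p (m + n choose m) = (\<Sum>i\<in>{1..?N}. carry_in p m n i)"
    by (simp add: Legendre_formula[OF assms, where N = ?N] sum.distrib)
  also have "\<dots> = (\<Sum>i\<in>{1..?N}. of_bool (carry_in p m n i \<noteq> 0))"
  proof (rule sum.cong)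
    fix i
    show "carry_in p m n i = of_bool (carry_in p m n i \<noteq> 0)"
      using carry_in_le_1[OF p(2), of m n i] by auto
  qed simp
  also have "\<dots> = card {i \<in> {1..?N}. carry_in p m n i \<noteq> 0}"
    by (simp add: Int_def)
  \<comment> \<open>The sum is indexed by the position a carry enters, \<open>num_carries\<close> by
    the position that produces it, hence the shift by \<open>Suc\<close>.\<close>
  also have "{i \<in> {1..?N}. carry_in p m n i \<noteq> 0} = Suc ` {i. carry_in p m n (Suc i) \<noteq> 0}"
  proof -
    have "i \<le> ?N" if "carry_in p m n i \<noteq> 0" for i
    proof (rule ccontr)
      assume "\<not> i \<le> ?N"
      then have "m + n < p ^ i"
        using less_power_self[OF p(1), of i] by linarith
      then have "carry_in p m n i = 0"
        unfolding carry_in_eq[OF p(2)] by simp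
      with that show False by simp
    qed
    moreover have "i \<noteq> 0" if "carry_in p m n i \<noteq> 0" for i
      using that by (cases i) auto
    ultimately show ?thesis
      by (auto simp: image_iff gr0_conv_Suc Suc_le_eq simp del: carry_in.simps)
  qed
  finally show ?thesis
    by (simp add: num_carries_def card_image)
qed

section \<open>Sets counted by alternating sum, with or without a prescribed maximum\<close>

section \<open>Alternating sums of sets\<close>

definition alt_sum_set :: "nat set \<Rightarrow> int" where
  "alt_sum_set D = alt_sum (rev (sorted_list_of_set D))"

lemma rev_sorted_list_of_set_insert_max:
  fixes D :: "nat set"
  assumes "finite D" "\<And>x. x \<in> D \<Longrightarrow> x < n"
  shows "rev (sorted_list_of_set (insert n D)) = n # rev (sorted_list_of_set D)"
proof -
  have "sorted_list_of_set (insert n D) = sorted_list_of_set D @ [n]"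
    by (rule sorted_distinct_set_unique)
      (use assms in \<open>auto simp: sorted_append less_imp_le simp del: sorted_list_of_set_insert_remove\<close>)
  then show ?thesis by simp
qed

lemma alt_sum_set_empty [simp]: "alt_sum_set {} = 0"
  by (simp add: alt_sum_set_def)

lemma alt_sum_set_insert_max:
  assumes "finite D" "\<And>x. x \<in> D \<Longrightarrow> x < n"
  shows "alt_sum_set (insert n D) = int n - alt_sum_set D"
  using rev_sorted_list_of_set_insert_max[OF assms] by (simp add: alt_sum_set_def)

text \<open>A new maximum \<open>b\<close> changes the sum to \<open>b - alt_sum_set A\<close>, and
  by induction the subtracted term lies between 0 and \<open>Max A < b\<close>.\<close>

lemma alt_sum_set_bounds:
  assumes "finite D" "D \<noteq> {}"
  shows "0 \<le> alt_sum_set D \<and> alt_sum_set D \<le> int (Max D) \<and> (0 \<notin> D \<longrightarrow> 0 < alt_sum_set D)"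
  using assms
proof (induction rule: finite_linorder_max_induct)
  case empty
  then show ?case by simp
next
  case (insert b A)
  have eq: "alt_sum_set (insert b A) = int b - alt_sum_set A"
    using insert by (intro alt_sum_set_insert_max) auto
  have "Max (insert b A) = b"
    using insert by (intro Max_eqI) (auto intro: less_imp_le)
  moreover have "Max A < b" if "A \<noteq> {}"
    using insert that by auto
  ultimately show ?case
    using insert.IH eq by (cases "A = {}") force+
qed

lemma alt_sum_set_nonneg: "finite D \<Longrightarrow> 0 \<le> alt_sum_set D"
  using alt_sum_set_bounds[of D] by (cases "D = {}") auto

text \<open>Removing and inserting \<open>N\<close> are inverse to each other and reflect
  \<open>s\<close> to \<open>N - s\<close>. Here \<open>s\<close> is an integer, so the reflected
  value may be negative.\<close>

lemma alt_sum_sets_containing_max: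
  assumes "N \<ge> 1"
  shows "{D. D \<subseteq> {1..N} \<and> N \<in> D \<and> alt_sum_set D = s}
    = insert N ` {D. D \<subseteq> {1..N - 1} \<and> alt_sum_set D = int N - s}" (is "?L = ?R")
proof (intro equalityI subsetI)
  fix D assume D: "D \<in> ?L"
  have sub: "D - {N} \<subseteq> {1..N - 1}" using D by auto
  have "x < N" if "x \<in> D - {N}" for x
    using subsetD[OF sub that] assms by auto
  then have "alt_sum_set (insert N (D - {N})) = int N - alt_sum_set (D - {N})"
    using finite_subset[OF sub] by (intro alt_sum_set_insert_max) auto
  then have "alt_sum_set (D - {N}) = int N - s" using D by (simp add: insert_absorb)
  then show "D \<in> ?R" using sub D by (intro image_eqI[of _ _ "D - {N}"]) auto
next
  fix D assume "D \<in> ?R"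
  then obtain E where E: "E \<subseteq> {1..N - 1}" "alt_sum_set E = int N - s" "D = insert N E"
    by blast
  have "x < N" if "x \<in> E" for x
    using subsetD[OF E(1) that] assms by auto
  then have "alt_sum_set D = int N - alt_sum_set E"
    unfolding E(3) using finite_subset[OF E(1)] by (intro alt_sum_set_insert_max) auto
  moreover have "D \<subseteq> {1..N}"
    using subsetD[OF E(1)] E(3) assms by fastforce
  ultimately show "D \<in> ?L" using E by auto
qed

lemma card_alt_sum_sets_containing_max:
  assumes "N \<ge> 1"
  shows "card {D. D \<subseteq> {1..N} \<and> N \<in> D \<and> alt_sum_set D = s}
    = card {D. D \<subseteq> {1..N - 1} \<and> alt_sum_set D = int N - s}"
  unfolding alt_sum_sets_containing_max[OF assms]
proof (rule card_image)
  have "N \<notin> D" if "D \<subseteq> {1..N - 1}" for D using that assms by auto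
  then show "inj_on (insert N) {D. D \<subseteq> {1..N - 1} \<and> alt_sum_set D = int N - s}"
    by (auto intro!: inj_onI simp: insert_ident)
qed

lemma card_alt_sum_sets:
  "card {D. D \<subseteq> {1..N} \<and> alt_sum_set D = int s} = N choose s"
proof (induction N arbitrary: s)
  case 0
  have "{D. D \<subseteq> {1..0::nat} \<and> alt_sum_set D = int s} = (if s = 0 then {{}} else {})"
    by auto
  then show ?case by simp
next
  case (Suc N)
  let ?A = "{D. D \<subseteq> {1..N} \<and> alt_sum_set D = int s}"
  let ?B = "{D. D \<subseteq> {1..Suc N} \<and> Suc N \<in> D \<and> alt_sum_set D = int s}"
  have "{D. D \<subseteq> {1..Suc N} \<and> alt_sum_set D = int s} = ?A \<union> ?B"
    by (auto simp: atLeastAtMostSuc_conv)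
  moreover have "finite ?A" "finite ?B"
    by (auto intro: finite_subset[of _ "Pow {1..N}"] finite_subset[of _ "Pow {1..Suc N}"])
  moreover have "?A \<inter> ?B = {}" by auto
  ultimately have "card {D. D \<subseteq> {1..Suc N} \<and> alt_sum_set D = int s} = card ?A + card ?B"
    by (simp add: card_Un_disjoint)
  also have "card ?A = N choose s" by (rule Suc)
  also have "card ?B = card {D. D \<subseteq> {1..N} \<and> alt_sum_set D = int (Suc N) - int s}"
    using card_alt_sum_sets_containing_max[of "Suc N" "int s"] by simp
  also have "(N choose s) + \<dots> = Suc N choose s"
  \<comment> \<open>If the reflected sum is a natural number, the induction hypothesis gives
    \<open>N choose (Suc N - s)\<close>, which is \<open>N choose (s - 1)\<close> for positive
    \<open>s\<close> and 0 for \<open>s = 0\<close>. Otherwise it is negative, no set attains it,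
    and both binomials vanish.\<close>
  proof (cases "s \<le> Suc N")
    case True
    then have "int (Suc N) - int s = int (Suc N - s)" by simp
    then have card: "card {D. D \<subseteq> {1..N} \<and> alt_sum_set D = int (Suc N) - int s} = N choose (Suc N - s)"
      by (simp only: Suc)
    then show ?thesis
    proof (cases s)
      case (Suc s')
      then show ?thesis
        using True card binomial_symmetric[of s' N] by simp
    qed simp
  next
    case False
    have "{D. D \<subseteq> {1..N} \<and> alt_sum_set D = int (Suc N) - int s} = {}"
    proof -
      have "alt_sum_set D \<noteq> int (Suc N) - int s" if "D \<subseteq> {1..N}" for D
        using alt_sum_set_nonneg[of D] False finite_subset[OF that] by auto
      then show ?thesis by blast
    qed
    then show ?thesis using False by (simp only: card.empty) (simp add: binomial_eq_0)
  qed
  finally show ?case .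
qed

section \<open>Stars and bars with a prescribed largest part\<close>

section \<open>Multisets with a given maximum\<close>

text \<open>The inserted 0 gives the empty multiset the value 0, in agreement with the convention
  for distinct parts.\<close>

abbreviation max_part :: "nat multiset \<Rightarrow> nat" where
  "max_part X \<equiv> Max (insert 0 (set_mset X))"

lemma max_part_eq_iff:
  "r \<ge> 1 \<Longrightarrow> max_part X = r \<longleftrightarrow> r \<in># X \<and> (\<forall>x\<in>#X. x \<le> r)"
  by (subst Max_eq_iff) auto

lemma multisets_with_max_part:
  assumes "r \<ge> 1"
  shows "{X. 0 \<notin># X \<and> max_part X = r \<and> size X = Suc m} = add_mset r ` multisets_of_size {1..r} m"
    (is "?L = ?R")
proof (intro equalityI subsetI)
  fix X assume X: "X \<in> ?L"
  then have r: "r \<in># X" and le: "\<forall>x\<in>#X. x \<le> r" using assms by (auto simp: max_part_eq_iff)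
  then have "X = add_mset r (X - {#r#})" by simp
  moreover have "X - {#r#} \<in> multisets_of_size {1..r} m"
  proof -
    have "1 \<le> x \<and> x \<le> r" if "x \<in># X - {#r#}" for x
      using in_diffD[OF that] X le by (cases x) auto
    then show ?thesis
      using X r by (auto simp: multisets_of_size_def size_Diff_singleton simp del: Max_insert)
  qed
  ultimately show "X \<in> ?R" by blast
next
  fix X assume "X \<in> ?R"
  then show "X \<in> ?L"
    using assms by (auto simp: max_part_eq_iff multisets_of_size_def simp del: Max_insert)
qed

text \<open>One copy of \<open>r\<close> is forced and the other \<open>m\<close> parts are
  arbitrary in \<open>{1..r}\<close>. The lower index \<open>r - 1\<close> is independent of
  \<open>m\<close>, which suits the later sum over sizes.\<close>

lemma card_multisets_with_max_part:
  assumes "r \<ge> 1"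
  shows "card {X. 0 \<notin># X \<and> max_part X = r \<and> size X = Suc m} = m + (r - 1) choose (r - 1)"
proof -
  have "card {X. 0 \<notin># X \<and> max_part X = r \<and> size X = Suc m} = (r + m - 1) choose m"
    unfolding multisets_with_max_part[OF assms]
    by (subst card_image) (auto simp: card_multisets_of_size intro: inj_onI)
  also have "\<dots> = m + (r - 1) choose (r - 1)"
    using assms binomial_symmetric[of m "m + (r - 1)"] by (simp add: add.commute)
  finally show ?thesis .
qed

lemma finite_multisets_with_max_part: "finite {X. 0 \<notin># X \<and> max_part X = r \<and> size X = m}"
proof (rule finite_subset)
  show "{X. 0 \<notin># X \<and> max_part X = r \<and> size X = m} \<subseteq> multisets_of_size {0..r} m"
    by (auto simp: multisets_of_size_def simp del: Max_insert)
qed auto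

lemma multisets_with_max_part_le:
  "{X. 0 \<notin># X \<and> max_part X = r \<and> size X \<le> t} = (\<Union>m\<le>t. {X. 0 \<notin># X \<and> max_part X = r \<and> size X = m})"
  by auto

lemma finite_multisets_with_max_part_le: "finite {X. 0 \<notin># X \<and> max_part X = r \<and> size X \<le> t}"
  unfolding multisets_with_max_part_le using finite_multisets_with_max_part by auto

text \<open>For positive \<open>r\<close> this is the hockey-stick identity over the sizes, where
  size 0 contributes nothing; for \<open>r = 0\<close> only the empty multiset qualifies.\<close>

lemma card_multisets_with_max_part_le:
  "card {X. 0 \<notin># X \<and> max_part X = r \<and> size X \<le> t} = (t + r - 1) choose r"
proof (cases "r = 0")
  case True
  have "X = {#}" if "0 \<notin># X" "max_part X = 0" for X
  proof (rule ccontr)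
    assume "X \<noteq> {#}"
    then obtain x where x: "x \<in># X" by blast
    then have "x \<le> max_part X" by (intro Max_ge) auto
    with that x show False by auto
  qed
  then have "{X. 0 \<notin># X \<and> max_part X = r \<and> size X \<le> t} = {{#}}"
    unfolding True by (intro equalityI subsetI) (blast, simp)
  then show ?thesis using True by simp
next
  case False
  have "card {X. 0 \<notin># X \<and> max_part X = r \<and> size X \<le> t}
      = (\<Sum>m\<le>t. card {X. 0 \<notin># X \<and> max_part X = r \<and> size X = m})"
    unfolding multisets_with_max_part_le
    by (rule card_UN_disjoint) (use finite_multisets_with_max_part in auto)
  also have "{X. 0 \<notin># X \<and> max_part X = r \<and> size X = 0} = {}"
    using False by auto
  then have "card {X. 0 \<notin># X \<and> max_part X = r \<and> size X = 0} = 0"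
    by (simp only: card.empty)
  then have "(\<Sum>m\<le>t. card {X. 0 \<notin># X \<and> max_part X = r \<and> size X = m})
      = (\<Sum>m<t. card {X. 0 \<notin># X \<and> max_part X = r \<and> size X = Suc m})"
    by (simp only: sum.atMost_shift add_0)
  also have "\<dots> = (\<Sum>m<t. m + (r - 1) choose (r - 1))"
    using False card_multisets_with_max_part by simp
  also have "\<dots> = (t + r - 1) choose r"
  proof -
    obtain q where "r = Suc q" using False by (cases r) auto
    then show ?thesis by (induction t) (auto simp: add.commute)
  qed
  finally show ?thesis .
qed

section \<open>The bijection with pairs \<open>(X, D)\<close> and the statistics in these
  terms\<close>

section \<open>Decomposition of a partition\<close>

definition merge :: "nat multiset \<Rightarrow> nat set \<Rightarrow> nat multiset" where
  "merge X D = X + X + mset_set D"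

lemma count_merge: "finite D \<Longrightarrow> count (merge X D) k = 2 * count X k + of_bool (k \<in> D)"
  by (simp add: merge_def count_mset_set')

lemma odd_parts_merge: "finite D \<Longrightarrow> {k. odd (count (merge X D) k)} = D"
  by (auto simp: count_merge)

text \<open>The parities of the counts recover \<open>D\<close>; the counts of \<open>X\<close> then
  follow by halving.\<close>

lemma inj_merge:
  assumes "finite D" "finite E" "merge X D = merge Y E"
  shows "X = Y \<and> D = E"
proof -
  have "D = E" using assms odd_parts_merge by metis
  moreover have "count X k = count Y k" for k
    using assms(3) count_merge[OF assms(1), of X k] count_merge[OF assms(2), of Y k] \<open>D = E\<close> by simp
  ultimately show ?thesis by (simp add: multiset_eq_iff)
qed

lemma merge_surj: "\<exists>X D. finite D \<and> l = merge X D"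
proof -
  \<comment> \<open>\<open>?X\<close> takes one part from each pair, and \<open>?D\<close> the parts
    left over.\<close>
  let ?X = "\<Sum>k\<in>set_mset l. replicate_mset (count l k div 2) k"
  let ?D = "{k. odd (count l k)}"
  have fin: "finite ?D"
    by (rule finite_subset[of _ "set_mset l"]) (auto simp flip: count_greater_zero_iff intro: odd_pos)
  have X: "count ?X k = count l k div 2" for k
    by (auto simp: count_sum not_in_iff)
  have "l = merge ?X ?D"
  proof (rule multiset_eqI)
    fix k
    show "count l k = count (merge ?X ?D) k"
      unfolding count_merge[OF fin] X by (simp add: odd_two_times_div_two_succ)
  qed
  with fin show ?thesis by blast
qed

lemma is_partition_merge: "finite D \<Longrightarrow> is_partition (merge X D) \<longleftrightarrow> 0 \<notin># X \<and> 0 \<notin> D"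
  by (auto simp: is_partition_def merge_def)

lemma unpaired_parts_merge: "finite D \<Longrightarrow> unpaired_parts (merge X D) = rev (sorted_list_of_set D)"
  by (simp add: unpaired_parts_def odd_parts_merge)

lemma residual_sum_merge: "finite D \<Longrightarrow> residual_sum (merge X D) = alt_sum_set D"
  by (simp add: residual_sum_def unpaired_parts_merge alt_sum_set_def)

lemma largest_paired_merge:
  assumes "finite D"
  shows "largest_paired (merge X D) = max_part X"
proof -
  have eq: "count (merge X D) k \<ge> 2 \<longleftrightarrow> k \<in># X" for k
    by (cases "count X k") (auto simp: count_merge[OF assms] not_in_iff count_greater_zero_iff[symmetric]
        simp del: count_greater_zero_iff)
  show ?thesis
    unfolding largest_paired_def eq by (cases "X = {#}") (auto simp: multiset_nonemptyE)
qed

lemma pairing_index_merge: "finite D \<Longrightarrow> pairing_index (merge X D) = int (max_part X) + alt_sum_set D"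
  by (simp add: pairing_index_def largest_paired_merge residual_sum_merge)

lemma pair_span_merge:
  assumes "finite D"
  shows "pair_span (merge X D) = 2 * size X"
proof -
  have "pair_span (merge X D) = (\<Sum>k\<in>set_mset (merge X D). 2 * count X k)"
    by (simp add: pair_span_def count_merge[OF assms])
  also have "\<dots> = (\<Sum>k\<in>set_mset X. 2 * count X k)"
    \<comment> \<open>Parts that occur only in \<open>D\<close> have count 0 in
      \<open>X\<close>.\<close>
    by (rule sum.mono_neutral_right) (auto simp: merge_def not_in_iff)
  also have "\<dots> = 2 * size X"
    by (simp add: size_multiset_overloaded_eq sum_distrib_left)
  finally show ?thesis .
qed

lemma residual_span_merge:
  assumes "finite D"
  shows "residual_span (merge X D) = (if D = {} then 0 else 2 * (int (Max D) - alt_sum_set D) + 1)"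
proof (cases "D = {}")
  case True
  then show ?thesis by (simp add: residual_span_def unpaired_parts_merge)
next
  case False
  have "rev (sorted_list_of_set (insert (Max D) (D - {Max D}))) =
      Max D # rev (sorted_list_of_set (D - {Max D}))"
    using assms False by (intro rev_sorted_list_of_set_insert_max) (auto simp: less_le)
  then show ?thesis
    using assms False by (simp add: residual_span_def unpaired_parts_merge residual_sum_merge insert_absorb)
qed

definition pairings :: "nat \<Rightarrow> nat \<Rightarrow> (nat multiset \<times> nat set) set" where
  "pairings a b = {(X, D). finite D \<and> 0 \<notin># X \<and> 0 \<notin> D \<and> int (max_part X) + alt_sum_set D = int a \<and>
      max (2 * int (size X)) (if D = {} then 0 else 2 * (int (Max D) - alt_sum_set D) + 1) = int b}"

lemma index_width_partitions_eq:
  "index_width_partitions a b = (\<lambda>(X, D). merge X D) ` pairings a b"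
  (is "_ = ?f ` _")
proof -
  have iff: "merge X D \<in> index_width_partitions a b \<longleftrightarrow> (X, D) \<in> pairings a b" if "finite D" for X D
    using that by (simp add: pairings_def index_width_partitions_def is_partition_merge pairing_index_merge
      pairing_width_def pair_span_merge residual_span_merge del: Max_insert)
  show ?thesis
  proof (intro equalityI subsetI)
    fix l assume l: "l \<in> index_width_partitions a b"
    obtain X D where "finite D" "l = merge X D" using merge_surj by blast
    with l iff show "l \<in> ?f ` pairings a b" by (intro image_eqI[of _ _ "(X, D)"]) auto
  next
    fix l assume "l \<in> ?f ` pairings a b"
    then obtain X D where XD: "(X, D) \<in> pairings a b" "l = merge X D" by auto
    then have "finite D" by (auto simp: pairings_def)
    with XD iff show "l \<in> index_width_partitions a b" by blast
  qed
qed

section \<open>Vandermonde convolution and the two parities of the width\<close>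

section \<open>Counting\<close>

text \<open>A subtraction is truncated only if the lower index is \<open>0\<close>, where the binomial coefficient
  is \<open>1\<close> regardless.\<close>

lemma rising_Vandermonde:
  "(\<Sum>i\<le>k. ((m + i - 1) choose i) * ((n + (k - i) - 1) choose (k - i))) = (m + n + k - 1) choose k"
proof -
  \<comment> \<open>Upper negation turns these binomials, up to sign, into generalized ones with
    upper index \<open>- m\<close>, to which the ordinary Vandermonde identity applies.\<close>
  have rising: "real ((m + i - 1) choose i) = (- 1) ^ i * ((- real m) gchoose i)" for m i
  proof (cases i)
    case (Suc j)
    then have "real (m + i - 1) = real m + real i - 1" by simp
    then show ?thesis
      unfolding gbinomial_minus binomial_gbinomial
      by (simp add: mult.assoc[symmetric] power_add[symmetric])
  qed simp
  have "(\<Sum>i\<le>k. real ((m + i - 1) choose i) * real ((n + (k - i) - 1) choose (k - i)))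
      = (\<Sum>i\<le>k. (- 1) ^ k * ((- real m gchoose i) * (- real n gchoose (k - i))))"
  proof (rule sum.cong)
    fix i assume "i \<in> {..k}"
    then have "(- 1) ^ k = (- 1 :: real) ^ i * (- 1) ^ (k - i)"
      by (simp add: power_add[symmetric])
    then show "real ((m + i - 1) choose i) * real ((n + (k - i) - 1) choose (k - i))
        = (- 1) ^ k * ((- real m gchoose i) * (- real n gchoose (k - i)))"
      unfolding rising by simp
  qed simp
  also have "\<dots> = (- 1) ^ k * ((- real (m + n)) gchoose k)"
    using gbinomial_Vandermonde[of "- real m" "- real n" k]
    by (simp add: sum_distrib_left[symmetric] atLeast0AtMost)
  also have "\<dots> = real ((m + n + k - 1) choose k)"
    by (rule rising[symmetric])
  finally show ?thesis
    by (simp only: of_nat_mult[symmetric] of_nat_sum[symmetric] of_nat_eq_iff)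
qed

text \<open>Disjoint first factors already make the products disjoint; in the applications they are
  separated by the value of \<open>max_part\<close>.\<close>

lemma card_UN_times:
  assumes "finite I" "\<And>i. i \<in> I \<Longrightarrow> finite (U i)" "\<And>i. i \<in> I \<Longrightarrow> finite (V i)"
    and "\<And>i j. i \<in> I \<Longrightarrow> j \<in> I \<Longrightarrow> i \<noteq> j \<Longrightarrow> U i \<inter> U j = {}"
  shows "card (\<Union>i\<in>I. U i \<times> V i) = (\<Sum>i\<in>I. card (U i) * card (V i))"
proof -
  have "card (\<Union>i\<in>I. U i \<times> V i) = (\<Sum>i\<in>I. card (U i \<times> V i))"
    using assms by (intro card_UN_disjoint) (auto simp: Times_Int_Times)
  then show ?thesis by (simp add: card_cartesian_product)
qed

text \<open>Twice the number of pairs is even and a nonzero residual span is odd, so the parity of the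
  width decides which of the two attains it. For even width the residual condition reads
  \<open>Max D \<le> alt_sum_set D + (m - 1)\<close>, which also covers \<open>D = {}\<close>.\<close>

lemma pairings_even_width:
  assumes "m \<ge> 1"
  shows "pairings (Suc k) (2 * m) =
    (\<Union>i\<le>k. {X. 0 \<notin># X \<and> max_part X = Suc i \<and> size X = m} \<times>
             {D. D \<subseteq> {1..(k - i) + (m - 1)} \<and> alt_sum_set D = int (k - i)})" (is "_ = ?R")
proof (intro equalityI subsetI)
  fix z assume "z \<in> pairings (Suc k) (2 * m)"
  then obtain X D where z: "z = (X, D)" and D: "finite D" "0 \<notin> D" and X: "0 \<notin># X"
    and ind: "int (max_part X) + alt_sum_set D = int (Suc k)"
    and wid: "max (2 * int (size X)) (if D = {} then 0 else 2 * (int (Max D) - alt_sum_set D) + 1)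
      = int (2 * m)"
    unfolding pairings_def by blast
  \<comment> \<open>The residual span is odd for nonempty \<open>D\<close>, so the even maximum must
    come from the pairs.\<close>
  have "2 * int (size X) = int (2 * m)"
  proof (cases "D = {}")
    case False
    then have "max (2 * int (size X)) (2 * (int (Max D) - alt_sum_set D) + 1) = int (2 * m)"
      using wid by simp
    then show ?thesis by (simp add: max_def split: if_splits) presburger
  qed (use wid in simp)
  then have size: "size X = m" by simp
  \<comment> \<open>There is at least one pair, so the largest paired part can be written
    \<open>Suc i\<close>, leaving alternating sum \<open>k - i\<close> for \<open>D\<close>.\<close>
  have "max_part X \<noteq> 0"
  proof -
    obtain x where "x \<in># X" using size assms by (cases X) auto
    moreover from this have "x \<le> max_part X" by (intro Max_ge) auto
    ultimately show ?thesis using X by (metis le_zero_eq)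
  qed
  then obtain i where i: "max_part X = Suc i" by (cases "max_part X") auto
  have "i \<le> k" and alt: "alt_sum_set D = int (k - i)"
    using ind i alt_sum_set_nonneg[OF D(1)] by linarith+
  have "x \<in> {1..(k - i) + (m - 1)}" if "x \<in> D" for x
  proof -
    have "D \<noteq> {}" using that by blast
    then have "2 * (int (Max D) - alt_sum_set D) + 1 \<le> int (2 * m)"
      using wid by simp
    then have "2 * int (Max D) + 1 \<le> 2 * int (k - i) + 2 * int m"
      unfolding alt by simp
    then have "Max D \<le> (k - i) + (m - 1)" using assms by linarith
    moreover have "x \<le> Max D" using that D by simp
    moreover have "x \<noteq> 0" using that D by metis
    ultimately show ?thesis by simp
  qed
  then show "z \<in> ?R" using z X size i alt \<open>i \<le> k\<close> by blast
next
  fix z assume "z \<in> ?R"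
  then obtain X D i where i: "i \<le> k" and z: "z = (X, D)"
    and X: "0 \<notin># X" "max_part X = Suc i" "size X = m"
    and D: "D \<subseteq> {1..(k - i) + (m - 1)}" "alt_sum_set D = int (k - i)"
    by blast
  have fin: "finite D" using D(1) finite_subset by blast
  have "2 * (int (Max D) - alt_sum_set D) + 1 \<le> int (2 * m)" if "D \<noteq> {}"
  proof -
    have "Max D \<le> (k - i) + (m - 1)" using Max_in[OF fin that] D(1) by auto
    then have "Max D + 1 \<le> (k - i) + m" using assms by linarith
    then have "int (Max D + 1) \<le> int ((k - i) + m)" by (simp only: of_nat_le_iff)
    then show ?thesis unfolding D(2) of_nat_add by simp
  qed
  then have "max (2 * int (size X)) (if D = {} then 0 else 2 * (int (Max D) - alt_sum_set D) + 1)
      = int (2 * m)"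
    using X(3) by simp
  moreover have "int (max_part X) + alt_sum_set D = int (Suc k)"
    unfolding X(2) D(2) using i by linarith
  moreover have "0 \<notin> D" using D(1) by auto
  ultimately show "z \<in> pairings (Suc k) (2 * m)"
    unfolding pairings_def z using fin X(1) by blast
qed

text \<open>An odd width is attained by the residual span, which fixes \<open>Max D\<close> as
  \<open>alt_sum_set D + t\<close>; the pairs need only satisfy \<open>size X \<le> t\<close>. Hence
  that maximum is required to lie in \<open>D\<close>, and \<open>X\<close> may be empty.\<close>

lemma pairings_odd_width:
  "pairings (Suc k) (Suc (2 * t)) =
    (\<Union>i\<le>k. {X. 0 \<notin># X \<and> max_part X = i \<and> size X \<le> t} \<times>
             {D. D \<subseteq> {1..Suc (k - i) + t} \<and> Suc (k - i) + t \<in> D \<and> alt_sum_set D = int (Suc (k - i))})"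
  (is "_ = ?R")
proof (intro equalityI subsetI)
  fix z assume "z \<in> pairings (Suc k) (Suc (2 * t))"
  then obtain X D where z: "z = (X, D)" and D: "finite D" "0 \<notin> D" and X: "0 \<notin># X"
    and ind: "int (max_part X) + alt_sum_set D = int (Suc k)"
    and wid: "max (2 * int (size X)) (if D = {} then 0 else 2 * (int (Max D) - alt_sum_set D) + 1)
      = int (Suc (2 * t))"
    unfolding pairings_def by blast
  have ne: "D \<noteq> {}"
  proof
    assume "D = {}"
    then have "2 * int (size X) = int (Suc (2 * t))" using wid by simp
    then show False by presburger
  qed
  then have "max (2 * int (size X)) (2 * (int (Max D) - alt_sum_set D) + 1) = int (Suc (2 * t))"
    using wid by simp
  then have "2 * (int (Max D) - alt_sum_set D) + 1 = int (Suc (2 * t)) \<and> 2 * int (size X) \<le> int (Suc (2 * t))"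
    by (simp add: max_def split: if_splits) presburger
  then have max: "int (Max D) = alt_sum_set D + int t" and size: "size X \<le> t"
    by auto
  \<comment> \<open>A nonempty set of positive parts has positive alternating sum, which forces
    \<open>max_part X \<le> k\<close>.\<close>
  have pos: "0 < alt_sum_set D" using alt_sum_set_bounds[OF D(1) ne] D(2) by blast
  define i where "i = max_part X"
  have i: "i \<le> k" and alt: "alt_sum_set D = int (Suc (k - i))"
    using ind pos unfolding i_def[symmetric] by linarith+
  have Max: "Max D = Suc (k - i) + t" using max alt by linarith
  have "x \<in> {1..Suc (k - i) + t}" if "x \<in> D" for x
    using Max_ge[OF D(1) that] D(2) that unfolding Max by (cases x) auto
  moreover have "Suc (k - i) + t \<in> D" using Max_in[OF D(1) ne] Max by simp
  ultimately show "z \<in> ?R" using z X size i alt i_def by blast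
next
  fix z assume "z \<in> ?R"
  then obtain X D i where i: "i \<le> k" and z: "z = (X, D)"
    and X: "0 \<notin># X" "max_part X = i" "size X \<le> t"
    and D: "D \<subseteq> {1..Suc (k - i) + t}" "Suc (k - i) + t \<in> D" "alt_sum_set D = int (Suc (k - i))"
    by blast
  have fin: "finite D" using D(1) finite_subset by blast
  have "Max D = Suc (k - i) + t" using D fin by (intro Max_eqI) auto
  then have "2 * (int (Max D) - alt_sum_set D) + 1 = int (Suc (2 * t))"
    using D(3) by simp
  moreover have "D \<noteq> {}" using D(2) by blast
  ultimately have "max (2 * int (size X)) (if D = {} then 0 else 2 * (int (Max D) - alt_sum_set D) + 1)
      = int (Suc (2 * t))"
    using X(3) by simp
  moreover have "int (max_part X) + alt_sum_set D = int (Suc k)"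
    unfolding X(2) D(3) using i by linarith
  moreover have "0 \<notin> D" using D(1) by auto
  ultimately show "z \<in> pairings (Suc k) (Suc (2 * t))"
    unfolding pairings_def z using fin X(1) by blast
qed

text \<open>Both parities reduce to \<open>rising_Vandermonde\<close>: with parameters
  \<open>m\<close>, \<open>m\<close> for width \<open>2 * m\<close>, and \<open>t\<close>,
  \<open>Suc t\<close> for width \<open>Suc (2 * t)\<close>. In each case the parameters add up to
  the width \<open>Suc b\<close>.\<close>

lemma card_pairings: "card (pairings (Suc k) (Suc b)) = k + b choose k"
proof -
  have fin: "finite {D. D \<subseteq> {1..N} \<and> P D}" for N :: nat and P
    by (rule finite_subset[of _ "Pow {1..N}"]) auto
  consider m where "Suc b = 2 * m" "m \<ge> 1" | t where "Suc b = Suc (2 * t)"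
  proof (cases "even (Suc b)")
    case True
    then obtain m where "Suc b = 2 * m" by (elim evenE)
    moreover from this have "m \<ge> 1" by linarith
    ultimately show ?thesis using that(1) by blast
  next
    case False
    then obtain t where "Suc b = 2 * t + 1" by (elim oddE)
    then show ?thesis using that(2)[of t] by simp
  qed
  then show ?thesis
  proof cases
    case (1 m)
    have "card (pairings (Suc k) (Suc b)) =
        (\<Sum>i\<le>k. card {X. 0 \<notin># X \<and> max_part X = Suc i \<and> size X = m} *
               card {D. D \<subseteq> {1..(k - i) + (m - 1)} \<and> alt_sum_set D = int (k - i)})"
      unfolding 1(1) pairings_even_width[OF 1(2)]
      by (rule card_UN_times) (use fin finite_multisets_with_max_part in auto)
    also have "\<dots> = (\<Sum>i\<le>k. ((m + i - 1) choose i) * ((m + (k - i) - 1) choose (k - i)))"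
    proof (rule sum.cong)
      fix i
      obtain q where q: "m = Suc q" using 1(2) by (cases m) auto
      have "card {X. 0 \<notin># X \<and> max_part X = Suc i \<and> size X = m} = (m + i - 1) choose i"
        using card_multisets_with_max_part[of "Suc i" q] q by simp
      moreover have "card {D. D \<subseteq> {1..(k - i) + (m - 1)} \<and> alt_sum_set D = int (k - i)}
          = (m + (k - i) - 1) choose (k - i)"
        unfolding card_alt_sum_sets using q by (simp add: add.commute)
      ultimately show "card {X. 0 \<notin># X \<and> max_part X = Suc i \<and> size X = m} *
          card {D. D \<subseteq> {1..(k - i) + (m - 1)} \<and> alt_sum_set D = int (k - i)}
          = ((m + i - 1) choose i) * ((m + (k - i) - 1) choose (k - i))"
        by (simp only:)
    qed simp
    also have "\<dots> = k + b choose k"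
    proof -
      have "m + m + k - 1 = k + b" using 1 by linarith
      then show ?thesis unfolding rising_Vandermonde by (simp only:)
    qed
    finally show ?thesis .
  next
    case (2 t)
    have "card (pairings (Suc k) (Suc b)) =
        (\<Sum>i\<le>k. card {X. 0 \<notin># X \<and> max_part X = i \<and> size X \<le> t} *
               card {D. D \<subseteq> {1..Suc (k - i) + t} \<and> Suc (k - i) + t \<in> D \<and> alt_sum_set D = int (Suc (k - i))})"
      unfolding 2 pairings_odd_width
      by (rule card_UN_times) (use fin finite_multisets_with_max_part_le in auto)
    also have "\<dots> = (\<Sum>i\<le>k. ((t + i - 1) choose i) * ((Suc t + (k - i) - 1) choose (k - i)))"
    proof (rule sum.cong)
      fix i
      \<comment> \<open>Removing the prescribed maximum reflects the sum \<open>Suc (k - i)\<close>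
        to \<open>t\<close>, whatever \<open>i\<close> is.\<close>
      have "card {D. D \<subseteq> {1..Suc (k - i) + t} \<and> Suc (k - i) + t \<in> D \<and> alt_sum_set D = int (Suc (k - i))}
          = card {D. D \<subseteq> {1..(k - i) + t} \<and> alt_sum_set D = int t}"
        using card_alt_sum_sets_containing_max[of "Suc (k - i) + t" "int (Suc (k - i))"] by simp
      also have "\<dots> = (Suc t + (k - i) - 1) choose (k - i)"
        unfolding card_alt_sum_sets using binomial_symmetric[of t "k - i + t"] by (simp add: add.commute)
      finally show "card {X. 0 \<notin># X \<and> max_part X = i \<and> size X \<le> t} *
          card {D. D \<subseteq> {1..Suc (k - i) + t} \<and> Suc (k - i) + t \<in> D \<and> alt_sum_set D = int (Suc (k - i))}
          = ((t + i - 1) choose i) * ((Suc t + (k - i) - 1) choose (k - i))"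
        by (simp only: card_multisets_with_max_part_le)
    qed simp
    also have "\<dots> = k + b choose k"
    proof -
      have "t + Suc t + k - 1 = k + b" using 2 by linarith
      then show ?thesis unfolding rising_Vandermonde by (simp only:)
    qed
    finally show ?thesis .
  qed
qed

lemma card_index_width_partitions: "card (index_width_partitions (Suc k) (Suc b)) = k + b choose k"
proof -
  have "inj_on (\<lambda>(X, D). merge X D) (pairings (Suc k) (Suc b))"
    unfolding pairings_def using inj_merge by (auto intro!: inj_onI simp del: Max_insert)
  then show ?thesis
    unfolding index_width_partitions_eq
    by (simp add: card_image card_pairings)
qed

theorem corollary2p7:
  fixes p a b :: nat
  assumes "prime p" and "a \<ge> 1" and "b \<ge> 1"
  shows "finite (index_width_partitions a b) \<and>
         index_width_partitions a b \<noteq> {} \<and>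
         multiplicity p (card (index_width_partitions a b)) = num_carries p (a - 1) (b - 1)"
proof -
  have card: "card (index_width_partitions a b) = (a - 1) + (b - 1) choose (a - 1)"
    using card_index_width_partitions[of "a - 1" "b - 1"] assms by simp
  \<comment> \<open>Infinite sets have \<open>card\<close> 0, so positivity yields finiteness as
    well as nonemptiness.\<close>
  then have "card (index_width_partitions a b) > 0"
    by simp
  then have "finite (index_width_partitions a b)" "index_width_partitions a b \<noteq> {}"
    unfolding card_gt_0_iff by auto
  then show ?thesis
    unfolding card using Kummer[OF assms(1)] by blast
qed

end
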